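(* Let $p=2\text{-}1\text{-}3$ (classical pattern). For integers $k,\ell\ge 1$ put $m=\max(k,\ell)$. Then: (i) $\displaystyle G_{p}^{12\ldots k,\,12\ldots \ell}(x) = x^{k+\ell-1}C^{k+1}(x)+\frac{x^m-x^{k+\ell-1}}{1-x}$. (ii) $\displaystyle G_{p}^{k(k-1)\ldots 1,\,12\ldots \ell}(x) = x^{k+\ell-1}C^2(x)$. (iii) $\displaystyle G_{p}^{k(k-1)\ldots 1,\,\ell(\ell-1)\ldots 1}(x) = x^{k+\ell-1}C^{\ell+1}(x)+\frac{x^m-x^{k+\ell-1}}{1-x}$. (iv) The generating function $\displaystyle G_p(x,y,z)=\sum_{k,\ell\geq0}G_{p}^{12\ldots k,\,\ell(\ell-1)\ldots 1}(x)\,y^kz^{\ell}$ equals $$\frac{1}{1-x(y+z)}\left( x(y+z+yz) +\frac{C(x)-1}{(1-xyC(x))(1-xzC(x))}\right).$$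
   Context: A permutation $\pi=\pi_1\cdots\pi_n$ of $\{1,\dots,n\}$ avoids the classical pattern $2\text{-}1\text{-}3$ if there are no indices $a<b<c$ with $\pi_b<\pi_a<\pi_c$. It begins with the pattern $12\ldots k$ (respectively $k(k-1)\ldots1$) if $n\ge k$ and $\pi_1<\cdots<\pi_k$ (respectively $\pi_1>\cdots>\pi_k$); it ends with the pattern $12\ldots\ell$ (respectively $\ell(\ell-1)\ldots 1$) if $n\ge\ell$ and $\pi_{n-\ell+1}<\cdots<\pi_n$ (respectively $\pi_{n-\ell+1}>\cdots>\pi_n$). The initial and final segments are allowed to overlap. $G_p^{q,r}(x)=\sum_{n\ge1}N_p^{q,r}(n)x^n$, where $N_p^{q,r}(n)$ is the number of permutations of $\{1,\dots,n\}$ that avoid $p$, begin with $q$ and end with $r$ (the empty permutation is not counted). For $k=0$ (respectively $\ell=0$) no condition is imposed on the beginning (respectively the end) of the permutation. $C(x)=\sum_{n\ge0}C_nx^n=\frac{1-\sqrt{1-4x}}{2x}$ is the generating function of the Catalan numbers, and $C^j(x)=(C(x))^j$. *)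

theory Defs
  imports "HOL-Computational_Algebra.Formal_Power_Series" "HOL-Combinatorics.Permutations"
begin

text \<open>
  A permutation \<open>\<pi>\<^sub>1\<dots>\<pi>\<^sub>n\<close> of \<open>{1..n}\<close> is a function \<open>\<pi>\<close> with \<open>\<pi> permutes {1..n}\<close>; its \<open>i\<close>-th
  letter is \<open>\<pi> i\<close>.  Conditions on permutations are predicates taking the length \<open>n\<close> and \<open>\<pi>\<close>.
\<close>

type_synonym perm_cond = "nat \<Rightarrow> (nat \<Rightarrow> nat) \<Rightarrow> bool"

definition avoids_213 :: perm_cond where
  "avoids_213 n \<pi> \<longleftrightarrow>
     \<not> (\<exists>a b c. 1 \<le> a \<and> a < b \<and> b < c \<and> c \<le> n \<and> \<pi> b < \<pi> a \<and> \<pi> a < \<pi> c)"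

text \<open>For pattern length \<open>0\<close> each of the following four conditions holds for every permutation.\<close>

definition begins_inc :: "nat \<Rightarrow> perm_cond" where
  "begins_inc k n \<pi> \<longleftrightarrow> k \<le> n \<and> strict_mono_on {1..k} \<pi>"

definition begins_dec :: "nat \<Rightarrow> perm_cond" where
  "begins_dec k n \<pi> \<longleftrightarrow> k \<le> n \<and> strict_antimono_on {1..k} \<pi>"

definition ends_inc :: "nat \<Rightarrow> perm_cond" where
  "ends_inc l n \<pi> \<longleftrightarrow> l \<le> n \<and> strict_mono_on {n - l + 1..n} \<pi>"

definition ends_dec :: "nat \<Rightarrow> perm_cond" where
  "ends_dec l n \<pi> \<longleftrightarrow> l \<le> n \<and> strict_antimono_on {n - l + 1..n} \<pi>"

definition perm_count :: "perm_cond \<Rightarrow> perm_cond \<Rightarrow> perm_cond \<Rightarrow> nat \<Rightarrow> nat" where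
  "perm_count p q r n = card {\<pi>. \<pi> permutes {1..n} \<and> p n \<pi> \<and> q n \<pi> \<and> r n \<pi>}"

definition perm_gf :: "perm_cond \<Rightarrow> perm_cond \<Rightarrow> perm_cond \<Rightarrow> rat fps" where
  "perm_gf p q r = Abs_fps (\<lambda>n. if n = 0 then 0 else of_nat (perm_count p q r n))"

definition catalan_gf :: "rat fps" where
  "catalan_gf = Abs_fps (\<lambda>n. of_nat ((2 * n) choose n) / of_nat (n + 1))"

text \<open>
  Power series in \<open>x, y, z\<close> are power series in \<open>z\<close> whose coefficients are power series in \<open>y\<close> whose
  coefficients are power series in \<open>x\<close>.  The function \<open>of_x\<close> embeds power series in \<open>x\<close>.  Division
  in this type is meaningful for denominators whose constant coefficient (in \<open>x, y, z\<close>) is nonzero.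
\<close>

type_synonym fps3 = "rat fps fps fps"

definition of_x :: "rat fps \<Rightarrow> fps3" where
  "of_x f = fps_const (fps_const f)"

definition var_x :: fps3 where
  "var_x = of_x fps_X"

definition var_y :: fps3 where
  "var_y = fps_const fps_X"

definition var_z :: fps3 where
  "var_z = fps_X"

definition gf_213_inc_dec :: fps3 where
  "gf_213_inc_dec =
     Abs_fps (\<lambda>l. Abs_fps (\<lambda>k. perm_gf avoids_213 (begins_inc k) (ends_dec l)))"

end

theory Submission
  imports Defs "HOL-Library.Tree"
begin

text \<open>
  A word with distinct letters and minimum \<open>b\<close> has the form \<open>u b v\<close>.  It avoids 213 iff \<open>u\<close> and \<open>v\<close>
  avoid 213 and every letter of \<open>u\<close> exceeds every letter of \<open>v\<close>, because \<open>x b y\<close> with \<open>x < y\<close> is an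
  occurrence of 213.  By iteration, the permutations of \<open>{1..n}\<close> that avoid 213 correspond to the
  binary trees with \<open>n\<close> nodes (\<open>bij_betw_word\<close>), with \<open>u\<close> and \<open>v\<close> as left and right subtree.  In
  particular, their series satisfies \<open>C = 1 + x C\<^sup>2\<close>.

  The monotone runs at both ends can be read off the tree.  Since \<open>b\<close> is the minimum, an increasing
  initial run of \<open>u b v\<close> stays in \<open>u\<close>, unless \<open>u\<close> is empty, in which case \<open>b\<close> is put in front of a run
  of \<open>v\<close>.  A decreasing initial run stays in \<open>u\<close>, unless \<open>u\<close> is decreasing; then it can
  include \<open>b\<close> as its last letter.  Only comparisons with \<open>b\<close> enter, so the same holds from right to left, and
  the final runs of a tree have the lengths of the initial runs of its mirror image.

  Every set of trees with prescribed runs therefore splits into products of such sets with the same or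
  smaller parameters, which gives linear equations for the series.  Write \<open>I\<^sub>k\<close> for trees that begin
  with an increasing run of length \<open>k\<close>; then \<open>I\<^sub>k\<^sub>+\<^sub>1 = x (I\<^sub>k\<^sub>+\<^sub>1 C + I\<^sub>k)\<close>, and so
  \<open>I\<^sub>k = x\<^sup>k C\<^sup>k\<^sup>+\<^sup>1\<close> (\<open>shape_gf_lead_inc\<close>).  For trees that begin with a decreasing
  run of length \<open>k\<close>, where \<open>k \<ge> 1\<close>, the series is \<open>x\<^sup>k C\<^sup>2\<close>, and it becomes \<open>x\<^sup>k\<^sup>-\<^sup>1 C\<close> when the
  decreasing word of length \<open>k - 1\<close> is added (\<open>shape_gf_lead_dec\<close>).  If the word begins with a
  decreasing run and ends with an increasing one, the two conditions concern different subtrees and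
  the series is a product (\<open>shape_gf_dec_inc\<close>).  Two increasing runs can overlap; the increasing words in
  which they share at least two letters account for the quotient by \<open>1 - x\<close> (\<open>shape_gf_inc_inc\<close>).  Two
  decreasing runs are the mirror image of this case.  An increasing run at the beginning and a decreasing
  run at the end give the recurrence \<open>H\<^sub>k\<^sub>l = x (I\<^sub>k I\<^sub>l + H\<^sub>k\<^sub>-\<^sub>1\<^sub>,\<^sub>l + H\<^sub>k\<^sub>,\<^sub>l\<^sub>-\<^sub>1)\<close> for \<open>k, l \<ge> 1\<close>, in
  which \<open>I\<^sub>l\<close> also counts final decreasing runs by mirror symmetry, with a
  further term \<open>x\<close> for \<open>k = l = 1\<close> (\<open>inc_dec_gf_Suc_Suc\<close>), and the series in three variables follows
  from multiplication by \<open>1 - x (y + z)\<close>.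
\<close>

section \<open>Words that avoid 213\<close>

fun avoids_213_word :: "nat list \<Rightarrow> bool" where
  "avoids_213_word [] \<longleftrightarrow> True"
| "avoids_213_word (a # w) \<longleftrightarrow> sorted_wrt (\<lambda>b c. \<not> (b < a \<and> a < c)) w \<and> avoids_213_word w"

lemma avoids_213_word_iff_nth:
  "avoids_213_word w \<longleftrightarrow>
    \<not> (\<exists>a b c. a < b \<and> b < c \<and> c < length w \<and> w ! b < w ! a \<and> w ! a < w ! c)"
proof (induction w)
  case (Cons x w)
  let ?P = "\<lambda>w a b c. a < b \<and> b < c \<and> c < length w \<and> w ! b < w ! a \<and> (w ! a :: nat) < w ! c"
  have "(\<exists>a b c. ?P (x # w) a b c) \<longleftrightarrow>
      (\<exists>b c. b < c \<and> c < length w \<and> w ! b < x \<and> x < w ! c) \<or> (\<exists>a b c. ?P w a b c)"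
    (is "?L \<longleftrightarrow> ?R1 \<or> ?R2")
  proof
    assume ?L
    then obtain a b c where abc: "?P (x # w) a b c" by blast
    then obtain b' c' where bc: "b = Suc b'" "c = Suc c'"
      by (metis less_nat_zero_code not0_implies_Suc)
    show "?R1 \<or> ?R2"
    proof (cases a)
      case 0
      then show ?thesis using abc bc by auto
    next
      case (Suc a')
      then have "?P w a' b' c'" using abc bc by auto
      then show ?thesis by blast
    qed
  next
    assume "?R1 \<or> ?R2"
    then show ?L
    proof
      assume ?R1
      then obtain b c where "b < c \<and> c < length w \<and> w ! b < x \<and> x < w ! c" by blast
      then have "?P (x # w) 0 (Suc b) (Suc c)" by simp
      then show ?L by blast
    next
      assume ?R2
      then obtain a b c where "?P w a b c" by blast
      then have "?P (x # w) (Suc a) (Suc b) (Suc c)" by simp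
      then show ?L by blast
    qed
  qed
  then show ?case using Cons.IH by (simp add: sorted_wrt_iff_nth_less) blast
qed simp

text \<open>
  In an occurrence \<open>a, b, c\<close> of 213 the last letter is the largest one.  Hence in a word \<open>u @ v\<close> whose
  first part lies above its second part, an occurrence that reaches into \<open>v\<close> lies in \<open>v\<close>.
\<close>
lemma avoids_213_word_append_greater:
  assumes "\<And>x y. x \<in> set u \<Longrightarrow> y \<in> set v \<Longrightarrow> y < x"
  shows "avoids_213_word (u @ v) \<longleftrightarrow> avoids_213_word u \<and> avoids_213_word v"
  using assms
proof (induction u)
  case (Cons a u)
  have "sorted_wrt (\<lambda>b c. \<not> (b < a \<and> a < c)) v"
    using Cons.prems by (intro sorted_wrt_mono_rel[OF _ sorted_wrt_true]) fastforce
  with Cons show ?case by (fastforce simp: sorted_wrt_append)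
qed simp

lemma avoids_213_word_Cons_min:
  assumes "\<And>x. x \<in> set v \<Longrightarrow> b < x"
  shows "avoids_213_word (b # v) \<longleftrightarrow> avoids_213_word v"
proof -
  have "sorted_wrt (\<lambda>x c. \<not> (x < b \<and> b < c)) v"
    using assms by (intro sorted_wrt_mono_rel[OF _ sorted_wrt_true]) fastforce
  then show ?thesis by simp
qed

text \<open>
  The letters \<open>x\<close>, \<open>b\<close>, \<open>y\<close> would form the pattern 213 if \<open>x < y\<close>.
\<close>
lemma avoids_213_word_split:
  assumes "avoids_213_word (u @ b # v)" and "x \<in> set u" and "b < x" and "y \<in> set v"
  shows "y \<le> x"
  using assms by (induction u) (auto simp: sorted_wrt_append not_less)

section \<open>Binary trees and words that avoid 213\<close>

type_synonym shape = "unit tree"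

text \<open>
  The first argument is the smallest letter, which stands at the root.  The letters of the right
  subtree are the next smallest ones, and the letters of the left subtree lie above them.  The letters
  are thus determined by the shape of the tree.
\<close>

fun word :: "nat \<Rightarrow> shape \<Rightarrow> nat list" where
  "word b Leaf = []"
| "word b (Node l _ r) = word (b + 1 + size r) l @ b # word (b + 1) r"

lemma length_word [simp]: "length (word b t) = size t"
  by (induction b t rule: word.induct) auto

lemma set_word [simp]: "set (word b t) = {b..<b + size t}"
  by (induction b t rule: word.induct) auto

lemma distinct_word: "distinct (word b t)"
  by (induction b t rule: word.induct) auto

lemma avoids_213_word_word: "avoids_213_word (word b t)"
proof (induction b t rule: word.induct)
  case (2 b l x r)
  have "avoids_213_word (b # word (b + 1) r)"
    using 2(2) by (subst avoids_213_word_Cons_min) auto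
  then show ?case
    using 2(1) by (subst word.simps, subst avoids_213_word_append_greater) auto
qed simp

lemma word_inject: "word b s = word b t \<Longrightarrow> s = t"
proof (induction b s arbitrary: t rule: word.induct)
  case (1 b)
  then show ?case by (cases t) auto
next
  case (2 b l x r)
  show ?case
  proof (cases t)
    case Leaf
    with 2 show ?thesis by simp
  next
    case (Node l' x' r')
    have "word (b + 1 + size r) l = word (b + 1 + size r') l' \<and> word (b + 1) r = word (b + 1) r'"
      using 2(3) Node by (subst append_Cons_eq_iff[symmetric]) auto
    moreover from this have "size r = size r'" by (metis length_word)
    ultimately show ?thesis using 2(1)[of l'] 2(2)[of r'] Node by simp
  qed
qed

text \<open>
  The letters on both sides of the minimum fill an interval, and those on the left exceed those on the
  right, so that each side is an interval as well and is the set of letters of a subtree.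
\<close>
lemma interval_split_lower:
  fixes A B :: "nat set"
  assumes "A \<union> B = {m..<n}" and "\<And>x y. x \<in> A \<Longrightarrow> y \<in> B \<Longrightarrow> y < x"
  shows "B = {m..<m + card B}" and "A = {m + card B..<n}"
proof -
  have fin: "finite A" "finite B" using assms(1) by (metis finite_Un finite_atLeastLessThan)+
  have "\<exists>k\<ge>m. B = {m..<k} \<and> A = {k..<n}"
  proof (cases "A = {}")
    case True
    then show ?thesis using assms(1) by (intro exI[of _ "max m n"]) auto
  next
    case False
    define k where "k = Min A"
    have k: "k \<in> A" "\<And>x. x \<in> A \<Longrightarrow> k \<le> x" using fin False by (auto simp: k_def)
    have k_le: "m \<le> k" "k < n" using assms(1) k(1) by auto
    have mem: "x \<in> A \<or> x \<in> B \<longleftrightarrow> m \<le> x \<and> x < n" for x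
      using assms(1) by (auto simp: set_eq_iff)
    have lt: "x < k" if "x \<in> B" for x using assms(2)[OF k(1) that] .
    have "x \<in> B \<longleftrightarrow> m \<le> x \<and> x < k" for x
      using mem[of x] lt[of x] k(2)[of x] k_le by (meson leD less_trans)
    moreover have "x \<in> A \<longleftrightarrow> k \<le> x \<and> x < n" for x
      using mem[of x] lt[of x] k(2)[of x] k_le by (meson leD le_trans)
    ultimately have "B = {m..<k}" and "A = {k..<n}" by (auto simp: set_eq_iff)
    then show ?thesis using k_le(1) by blast
  qed
  then obtain k where k: "m \<le> k" "B = {m..<k}" "A = {k..<n}" by blast
  then have "m + card B = k" by simp
  with k show "B = {m..<m + card B}" and "A = {m + card B..<n}" by simp_all
qed

text \<open>
  Cutting the word at its minimum gives the words of the two subtrees.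
\<close>
lemma word_surj:
  assumes "distinct w" and "set w = {b..<b + length w}" and "avoids_213_word w"
  shows "\<exists>t. word b t = w"
  using assms
proof (induction "length w" arbitrary: w b rule: less_induct)
  case less
  show ?case
  proof (cases "w = []")
    case True
    then have "word b Leaf = w" by simp
    then show ?thesis by blast
  next
    case False
    then have "b \<in> set w" using less.prems by simp
    then obtain u v where w: "w = u @ b # v" by (meson split_list)
    have "set u \<union> set v = set w - {b}" using less.prems(1) w by auto
    also have "\<dots> = {b + 1..<b + length w}" unfolding less.prems(2) by auto
    finally have uv: "set u \<union> set v = {b + 1..<b + length w}" .
    have lt: "y < x" if "x \<in> set u" "y \<in> set v" for x y
    proof -
      have "b < x" using uv that by (metis UnI1 Suc_eq_plus1 Suc_le_eq atLeastLessThan_iff)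
      then have "y \<le> x" using avoids_213_word_split less.prems(3) that unfolding w by blast
      moreover have "x \<noteq> y" using less.prems(1) that w by auto
      ultimately show ?thesis by simp
    qed
    have dist: "distinct u" "distinct v" using less.prems(1) w by auto
    have gt: "b < x" if "x \<in> set u \<union> set v" for x using that unfolding uv by simp
    have "set v = {b + 1..<b + 1 + length v}"
      using interval_split_lower(1)[OF uv lt] dist by (simp add: distinct_card)
    moreover have "set u = {b + 1 + length v..<b + 1 + length v + length u}"
      using interval_split_lower(2)[OF uv lt] dist w by (simp add: distinct_card add_ac)
    moreover have "avoids_213_word u" "avoids_213_word v"
    proof -
      have "avoids_213_word u \<and> avoids_213_word (b # v)"
        using less.prems(3) lt gt unfolding w by (subst (asm) avoids_213_word_append_greater) auto
      then show "avoids_213_word u" "avoids_213_word v" by auto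
    qed
    moreover have "length u < length w" "length v < length w" using w by auto
    ultimately obtain l r where l: "word (b + 1 + length v) l = u" and r: "word (b + 1) r = v"
      using less.hyps[of u "b + 1 + length v"] less.hyps[of v "b + 1"] dist by auto
    have "size r = length v" using r by (metis length_word)
    then have "word b (Node l () r) = w" using l r w by simp
    then show ?thesis by blast
  qed
qed

lemma bij_betw_word:
  "bij_betw (word b) {t. size t = n}
    {w. distinct w \<and> set w = {b..<b + n} \<and> avoids_213_word w}"
proof (rule bij_betw_imageI)
  show "inj_on (word b) {t. size t = n}" by (auto intro: inj_onI word_inject)
  have "w \<in> word b ` {t. size t = n}"
    if w: "distinct w" "set w = {b..<b + n}" "avoids_213_word w" for w
  proof -
    have n: "length w = n" using w by (metis card_atLeastLessThan diff_add_inverse distinct_card)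
    then obtain t where "word b t = w" using word_surj w by blast
    then show ?thesis using n by (metis (mono_tags, lifting) imageI length_word mem_Collect_eq)
  qed
  then show "word b ` {t. size t = n} = {w. distinct w \<and> set w = {b..<b + n} \<and> avoids_213_word w}"
    by (auto simp: distinct_word avoids_213_word_word)
qed

section \<open>Monotone runs of a word and of its tree\<close>

definition begins :: "(nat \<Rightarrow> nat \<Rightarrow> bool) \<Rightarrow> nat \<Rightarrow> nat list \<Rightarrow> bool" where
  "begins R k w \<longleftrightarrow> k \<le> length w \<and> sorted_wrt R (take k w)"

text \<open>
  An increasing initial run that starts in a nonempty \<open>u\<close> ends before the minimum \<open>b\<close>, while
  \<open>b\<close> itself prolongs any increasing run that it precedes.  Since only comparisons with \<open>b\<close>
  enter, the lemma also applies to the reverse of a word that avoids 213, in which the part with the larger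
  letters comes last, and so describes final runs.
\<close>
lemma begins_less_split_at_min:
  assumes "\<And>x. x \<in> set u \<union> set v \<Longrightarrow> b < x"
  shows "begins (<) k (u @ b # v) \<longleftrightarrow> (if u = [] then begins (<) (k - 1) v else begins (<) k u)"
proof (cases "u = []")
  case True
  then show ?thesis using assms
    by (cases k) (auto simp: begins_def dest: in_set_takeD)
next
  case False
  show ?thesis
  proof (cases "k \<le> length u")
    case True
    with False show ?thesis by (simp add: begins_def)
  next
    case k: False
    then obtain j where j: "k - length u = Suc j" by (metis Suc_diff_Suc not_le)
    have "hd u \<in> set u" using False by simp
    moreover have "b < hd u" using assms \<open>hd u \<in> set u\<close> by simp
    ultimately show ?thesis using False k
      by (auto simp: begins_def sorted_wrt_append j intro!: bexI[of _ "hd u"])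
  qed
qed

text \<open>
  A decreasing initial run can include the minimum \<open>b\<close>, but then it includes all of \<open>u\<close> and
  stops at \<open>b\<close>.
\<close>
lemma begins_greater_split_at_min:
  assumes "\<And>x. x \<in> set u \<union> set v \<Longrightarrow> b < x"
  shows "begins (>) k (u @ b # v) \<longleftrightarrow>
    begins (>) k u \<or> k = Suc (length u) \<and> begins (>) (length u) u"
proof -
  consider "k \<le> length u" | "k = Suc (length u)" | "k > Suc (length u)" by linarith
  then show ?thesis
  proof cases
    case 1
    then show ?thesis by (simp add: begins_def)
  next
    case 2
    then show ?thesis using assms by (simp add: begins_def sorted_wrt_append)
  next
    case 3
    then obtain j where j: "k - length u = Suc (Suc j)"
      by (metis Suc_diff_Suc Suc_lessD)
    show ?thesis
    proof (cases v)
      case Nil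
      with 3 show ?thesis by (simp add: begins_def)
    next
      case (Cons c v')
      then have "b < c" using assms by simp
      with 3 Cons show ?thesis by (auto simp: begins_def sorted_wrt_append j)
    qed
  qed
qed

text \<open>
  The lengths of the longest increasing and decreasing initial runs of the word of a tree, computed by
  splitting the word at its minimum.
\<close>
fun lead_inc :: "shape \<Rightarrow> nat" where
  "lead_inc Leaf = 0"
| "lead_inc (Node l _ r) = (if l = Leaf then Suc (lead_inc r) else lead_inc l)"

fun lead_dec :: "shape \<Rightarrow> nat" where
  "lead_dec Leaf = 0"
| "lead_dec (Node l _ r) = (if lead_dec l = size l then Suc (size l) else lead_dec l)"

lemma lead_dec_le: "lead_dec t \<le> size t"
  by (induction t) auto

lemma word_eq_Nil_iff [simp]: "word b t = [] \<longleftrightarrow> t = Leaf"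
  by (cases t) auto

lemma begins_less_word: "begins (<) k (word b t) \<longleftrightarrow> k \<le> lead_inc t"
proof (induction b t arbitrary: k rule: word.induct)
  case (2 b l x r)
  then show ?case
    by (subst word.simps, subst begins_less_split_at_min) auto
qed (simp add: begins_def)

text \<open>
  The reverse of the word of a tree is not the word of the mirrored tree (it need not avoid 213), but
  both are cut at their minimum into parts of the same sizes, and the runs depend on nothing else.
\<close>
lemma begins_less_rev_word: "begins (<) k (rev (word b t)) \<longleftrightarrow> k \<le> lead_inc (mirror t)"
proof (induction b t arbitrary: k rule: word.induct)
  case (2 b l x r)
  have "rev (word b (Node l x r)) = rev (word (b + 1) r) @ b # rev (word (b + 1 + size r) l)"
    by simp
  then show ?case
    using 2 by (subst \<open>rev (word b (Node l x r)) = _\<close>, subst begins_less_split_at_min) auto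
qed (simp add: begins_def)

lemma begins_greater_word: "begins (>) k (word b t) \<longleftrightarrow> k \<le> lead_dec t"
proof (induction b t arbitrary: k rule: word.induct)
  case (2 b l x r)
  then show ?case
    using lead_dec_le[of l] by (subst word.simps, subst begins_greater_split_at_min) auto
qed (simp add: begins_def)

lemma begins_greater_rev_word: "begins (>) k (rev (word b t)) \<longleftrightarrow> k \<le> lead_dec (mirror t)"
proof (induction b t arbitrary: k rule: word.induct)
  case (2 b l x r)
  have "rev (word b (Node l x r)) = rev (word (b + 1) r) @ b # rev (word (b + 1 + size r) l)"
    by simp
  then show ?case
    using 2 lead_dec_le[of "mirror r"]
    by (subst \<open>rev (word b (Node l x r)) = _\<close>, subst begins_greater_split_at_min) auto
qed (simp add: begins_def)

section \<open>Permutations as words\<close>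

definition perm_word :: "nat \<Rightarrow> (nat \<Rightarrow> nat) \<Rightarrow> nat list" where
  "perm_word n \<pi> = map \<pi> [1..<Suc n]"

lemma perm_word_nth: "i < n \<Longrightarrow> perm_word n \<pi> ! i = \<pi> (Suc i)"
  by (simp add: perm_word_def del: upt_Suc)

lemma length_perm_word [simp]: "length (perm_word n \<pi>) = n"
  by (simp add: perm_word_def)

lemma bij_betw_perm_word:
  "bij_betw (perm_word n) {\<pi>. \<pi> permutes {1..n}} {w. distinct w \<and> set w = {1..n}}"
proof (rule bij_betw_imageI)
  show "inj_on (perm_word n) {\<pi>. \<pi> permutes {1..n}}"
  proof (rule inj_onI)
    fix \<pi> \<sigma>
    assume perm: "\<pi> \<in> {\<pi>. \<pi> permutes {1..n}}" "\<sigma> \<in> {\<pi>. \<pi> permutes {1..n}}"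
      and eq: "perm_word n \<pi> = perm_word n \<sigma>"
    show "\<pi> = \<sigma>"
    proof
      fix i
      show "\<pi> i = \<sigma> i"
      proof (cases "i \<in> {1..n}")
        case True
        then show ?thesis using eq by (simp add: perm_word_def del: upt_Suc)
      next
        case False
        then show ?thesis using perm by (simp add: permutes_not_in)
      qed
    qed
  qed
  have "w \<in> perm_word n ` {\<pi>. \<pi> permutes {1..n}}" if w: "distinct w" "set w = {1..n}" for w
  proof -
    define \<pi> where "\<pi> i = (if i \<in> {1..n} then w ! (i - 1) else i)" for i
    have n: "length w = n" using w by (metis card_atLeastAtMost diff_Suc_1 distinct_card)
    have "perm_word n \<pi> = w"
      using n by (auto intro!: nth_equalityI simp: perm_word_nth \<pi>_def)
    moreover have "\<pi> permutes {1..n}"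
    proof (rule bij_imp_permutes)
      have "inj_on \<pi> {1..n}"
        using w n by (auto simp: inj_on_def \<pi>_def nth_eq_iff_index_eq)
      moreover have "\<pi> ` {1..n} = set (perm_word n \<pi>)"
        by (auto simp: perm_word_def simp del: upt_Suc)
      ultimately show "bij_betw \<pi> {1..n} {1..n}"
        using w \<open>perm_word n \<pi> = w\<close> by (simp add: bij_betw_def)
    qed (auto simp: \<pi>_def)
    ultimately show ?thesis by blast
  qed
  moreover have "distinct (perm_word n \<pi>) \<and> set (perm_word n \<pi>) = {1..n}"
    if "\<pi> permutes {1..n}" for \<pi>
    using permutes_image[OF that] permutes_inj_on[OF that]
    by (simp add: perm_word_def distinct_map atLeastLessThanSuc_atLeastAtMost del: upt_Suc)
  ultimately show "perm_word n ` {\<pi>. \<pi> permutes {1..n}} = {w. distinct w \<and> set w = {1..n}}"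
    by auto
qed

lemma avoids_213_iff_word: "avoids_213 n \<pi> \<longleftrightarrow> avoids_213_word (perm_word n \<pi>)"
proof -
  have "(\<exists>a b c. 1 \<le> a \<and> a < b \<and> b < c \<and> c \<le> n \<and> \<pi> b < \<pi> a \<and> \<pi> a < \<pi> c) \<longleftrightarrow>
    (\<exists>a b c. a < b \<and> b < c \<and> c < n \<and> \<pi> (Suc b) < \<pi> (Suc a) \<and> \<pi> (Suc a) < \<pi> (Suc c))"
    (is "?L \<longleftrightarrow> ?R")
  proof
    assume ?L
    then obtain a b c where "1 \<le> a \<and> a < b \<and> b < c \<and> c \<le> n \<and> \<pi> b < \<pi> a \<and> \<pi> a < \<pi> c"
      by blast
    then show ?R
      by (intro exI[of _ "a - 1"] exI[of _ "b - 1"] exI[of _ "c - 1"]) auto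
  next
    assume ?R
    then obtain a b c
      where "a < b \<and> b < c \<and> c < n \<and> \<pi> (Suc b) < \<pi> (Suc a) \<and> \<pi> (Suc a) < \<pi> (Suc c)"
      by blast
    then show ?L by (intro exI[of _ "Suc a"] exI[of _ "Suc b"] exI[of _ "Suc c"]) auto
  qed
  also have "\<dots> \<longleftrightarrow> \<not> avoids_213_word (perm_word n \<pi>)"
  proof -
    have "(a < b \<and> b < c \<and> c < n \<and> \<pi> (Suc b) < \<pi> (Suc a) \<and> \<pi> (Suc a) < \<pi> (Suc c)) \<longleftrightarrow>
      (a < b \<and> b < c \<and> c < n \<and> perm_word n \<pi> ! b < perm_word n \<pi> ! a
        \<and> perm_word n \<pi> ! a < perm_word n \<pi> ! c)" for a b c
      by (cases "a < b \<and> b < c \<and> c < n") (simp_all only: perm_word_nth, auto simp: perm_word_nth)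
    then show ?thesis
      unfolding avoids_213_word_iff_nth not_not length_perm_word by (simp only:)
  qed
  finally show ?thesis by (simp add: avoids_213_def)
qed

lemma sorted_wrt_map_upt:
  "sorted_wrt R (map f [a..<b]) \<longleftrightarrow> (\<forall>i\<in>{a..<b}. \<forall>j\<in>{a..<b}. i < j \<longrightarrow> R (f i) (f j))"
  by (induction b) (auto simp: sorted_wrt_append less_Suc_eq)

lemma take_perm_word: "k \<le> n \<Longrightarrow> take k (perm_word n \<pi>) = map \<pi> [1..<Suc k]"
  by (simp add: perm_word_def take_map del: upt_Suc)

lemma take_rev_perm_word: "l \<le> n \<Longrightarrow> take l (rev (perm_word n \<pi>)) = rev (map \<pi> [n - l + 1..<Suc n])"
  by (simp add: perm_word_def take_rev drop_map del: upt_Suc)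

lemma begins_inc_iff_word: "begins_inc k n \<pi> \<longleftrightarrow> begins (<) k (perm_word n \<pi>)"
  by (auto simp: begins_inc_def begins_def take_perm_word sorted_wrt_map_upt monotone_on_def
    simp del: upt_Suc)

lemma begins_dec_iff_word: "begins_dec k n \<pi> \<longleftrightarrow> begins (>) k (perm_word n \<pi>)"
  by (auto simp: begins_dec_def begins_def take_perm_word sorted_wrt_map_upt monotone_on_def
    simp del: upt_Suc)

lemma ends_inc_iff_word: "ends_inc l n \<pi> \<longleftrightarrow> begins (>) l (rev (perm_word n \<pi>))"
  by (auto simp: ends_inc_def begins_def take_rev_perm_word sorted_wrt_rev sorted_wrt_map_upt
    monotone_on_def simp del: upt_Suc)

lemma ends_dec_iff_word: "ends_dec l n \<pi> \<longleftrightarrow> begins (<) l (rev (perm_word n \<pi>))"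
  by (auto simp: ends_dec_def begins_def take_rev_perm_word sorted_wrt_rev sorted_wrt_map_upt
    monotone_on_def simp del: upt_Suc)

lemma card_Collect_bij_betw:
  assumes "bij_betw f A B"
  shows "card {x \<in> A. P (f x)} = card {y \<in> B. P y}"
proof (rule bij_betw_same_card[of f])
  show "bij_betw f {x \<in> A. P (f x)} {y \<in> B. P y}"
    using assms by (auto simp: bij_betw_def inj_on_def)
qed

lemma perm_count_eq_card_shapes:
  assumes "\<And>\<pi>. q n \<pi> \<longleftrightarrow> Q (perm_word n \<pi>)" and "\<And>\<pi>. r n \<pi> \<longleftrightarrow> R (perm_word n \<pi>)"
  shows "perm_count avoids_213 q r n = card {t. size t = n \<and> Q (word 1 t) \<and> R (word 1 t)}"
proof -
  let ?P = "\<lambda>w. Q w \<and> R w"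
  have "perm_count avoids_213 q r n =
      card {\<pi> \<in> {\<pi>. \<pi> permutes {1..n}}. avoids_213_word (perm_word n \<pi>) \<and> ?P (perm_word n \<pi>)}"
    by (simp add: perm_count_def avoids_213_iff_word assms)
  also have "\<dots> = card {w \<in> {w. distinct w \<and> set w = {1..n}}. avoids_213_word w \<and> ?P w}"
    by (rule card_Collect_bij_betw[OF bij_betw_perm_word])
  also have "\<dots> = card {w \<in> {w. distinct w \<and> set w = {1..<1 + n} \<and> avoids_213_word w}. ?P w}"
    by (rule arg_cong[where f = card]) (auto simp: atLeastLessThanSuc_atLeastAtMost)
  also have "\<dots> = card {t \<in> {t. size t = n}. ?P (word 1 t)}"
    by (rule card_Collect_bij_betw[OF bij_betw_word, symmetric])
  finally show ?thesis by simp
qed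

section \<open>Generating functions of sets of trees\<close>

unbundle fps_syntax

definition shape_gf :: "shape set \<Rightarrow> rat fps" where
  "shape_gf S = Abs_fps (\<lambda>n. of_nat (card {t \<in> S. size t = n}))"

definition nodes :: "shape set \<Rightarrow> shape set \<Rightarrow> shape set" where
  "nodes A B = {Node l () r | l r. l \<in> A \<and> r \<in> B}"

lemma Node_in_nodes_iff [simp]: "Node l x r \<in> nodes A B \<longleftrightarrow> l \<in> A \<and> r \<in> B"
  by (auto simp: nodes_def)

lemma Leaf_notin_nodes [simp]: "Leaf \<notin> nodes A B"
  by (auto simp: nodes_def)

lemma shapes_of_size_Suc:
  "{t \<in> nodes A B. size t = Suc n} =
    (\<lambda>(l, r). Node l () r) ` (\<Union>i\<in>{0..n}. {t \<in> A. size t = i} \<times> {t \<in> B. size t = n - i})"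
proof (intro set_eqI iffI)
  fix t
  assume t: "t \<in> {t \<in> nodes A B. size t = Suc n}"
  then obtain l r where lr: "t = Node l () r" "l \<in> A" "r \<in> B" by (auto simp: nodes_def)
  then have "(l, r) \<in> (\<Union>i\<in>{0..n}. {t \<in> A. size t = i} \<times> {t \<in> B. size t = n - i})"
    using t by auto
  with lr(1) show "t \<in> (\<lambda>(l, r). Node l () r) `
      (\<Union>i\<in>{0..n}. {t \<in> A. size t = i} \<times> {t \<in> B. size t = n - i})"
    by (intro image_eqI[of _ _ "(l, r)"]) simp_all
qed auto

lemma finite_shapes_of_size [simp]: "finite {t :: shape. size t = n}"
proof (induction n rule: less_induct)
  case (less n)
  show ?case
  proof (cases n)
    case 0
    then have "{t :: shape. size t = n} = {Leaf}" by auto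
    then show ?thesis by simp
  next
    case (Suc m)
    have "t \<in> nodes UNIV UNIV" if "size t = Suc m" for t using that by (cases t) auto
    then have "{t :: shape. size t = n} = {t \<in> nodes UNIV UNIV. size t = Suc m}"
      using Suc by auto
    then show ?thesis
      unfolding shapes_of_size_Suc using less Suc by auto
  qed
qed

lemma finite_shapes_of_size' [simp]: "finite {t \<in> S :: shape set. size t = n}"
  by (rule finite_subset[OF _ finite_shapes_of_size[of n]]) auto

lemma shape_gf_nodes: "shape_gf (nodes A B) = fps_X * (shape_gf A * shape_gf B)"
proof (rule fps_ext)
  fix n
  show "shape_gf (nodes A B) $ n = (fps_X * (shape_gf A * shape_gf B)) $ n"
  proof (cases n)
    case 0
    have "{t \<in> nodes A B. size t = 0} = {}" by auto
    with 0 show ?thesis by (simp add: shape_gf_def del: eq_size_0)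
  next
    case (Suc m)
    have "card {t \<in> nodes A B. size t = Suc m} =
        card (\<Union>i\<in>{0..m}. {t \<in> A. size t = i} \<times> {t \<in> B. size t = m - i})"
      unfolding shapes_of_size_Suc by (rule card_image) (auto simp: inj_on_def)
    also have "\<dots> = (\<Sum>i=0..m. card ({t \<in> A. size t = i} \<times> {t \<in> B. size t = m - i}))"
      by (rule card_UN_disjoint) auto
    also have "rat_of_nat \<dots> = (shape_gf A * shape_gf B) $ m"
      by (simp add: shape_gf_def fps_mult_nth card_cartesian_product)
    also have "\<dots> = (fps_X * (shape_gf A * shape_gf B)) $ Suc m" by simp
    finally show ?thesis using Suc by (simp add: shape_gf_def)
  qed
qed

lemma shape_gf_Un: "A \<inter> B = {} \<Longrightarrow> shape_gf (A \<union> B) = shape_gf A + shape_gf B"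
proof -
  assume disj: "A \<inter> B = {}"
  have "{t \<in> A \<union> B. size t = n} = {t \<in> A. size t = n} \<union> {t \<in> B. size t = n}" for n
    by auto
  then show ?thesis using disj
    by (intro fps_ext) (simp add: shape_gf_def card_Un_disjoint disjoint_iff)
qed

lemma shape_gf_empty [simp]: "shape_gf {} = 0"
  by (rule fps_ext) (simp add: shape_gf_def)

lemma shape_gf_singleton: "shape_gf {t} = fps_X ^ size t"
proof (rule fps_ext)
  fix n
  have "{s \<in> {t}. size s = n} = (if size t = n then {t} else {})" by auto
  then show "shape_gf {t} $ n = (fps_X ^ size t :: rat fps) $ n"
    by (simp add: shape_gf_def)
qed

lemma shape_gf_mirror: "shape_gf {t. mirror t \<in> S} = shape_gf S"
proof -
  have "card {t \<in> {t. mirror t \<in> S}. size t = n} = card {t \<in> S. size t = n}" for n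
    by (rule bij_betw_same_card[of mirror], rule bij_betw_byWitness[where f' = mirror]) auto
  then show ?thesis by (simp add: shape_gf_def)
qed

abbreviation shapes_gf :: "rat fps" where
  "shapes_gf \<equiv> shape_gf UNIV"

lemma shapes_gf_equation: "shapes_gf = 1 + fps_X * (shapes_gf * shapes_gf)"
proof -
  have "t \<in> {Leaf} \<union> nodes UNIV UNIV" for t by (cases t) auto
  then have "(UNIV :: shape set) = {Leaf} \<union> nodes UNIV UNIV" by blast
  then have "shapes_gf = shape_gf ({Leaf} \<union> nodes UNIV UNIV)" by (rule arg_cong)
  also have "\<dots> = 1 + fps_X * (shapes_gf * shapes_gf)"
    by (subst shape_gf_Un) (simp_all add: shape_gf_nodes shape_gf_singleton)
  finally show ?thesis .
qed

section \<open>The Catalan series\<close>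

text \<open>
  The differential equation is the two-term recurrence
  \<open>(n + 2) c\<^sub>n\<^sub>+\<^sub>1 = (4 n + 2) c\<^sub>n\<close> in the language of series.  It follows from the quadratic equation by
  \<open>F' = F\<^sup>2 + 2 x F F'\<close> and \<open>(1 - 2 x F)\<^sup>2 = 1 - 4 x\<close>.
\<close>
lemma catalan_quadratic_linear_ODE:
  fixes F :: "rat fps"
  assumes F: "F = 1 + fps_X * (F * F)"
  shows "fps_X * (1 - 4 * fps_X) * fps_deriv F + (1 - 2 * fps_X) * F = 1"
proof -
  define D where "D = fps_deriv F"
  have X: "fps_X * (F * F) = F - 1" using F by (simp add: algebra_simps)
  have "D = fps_deriv (1 + fps_X * (F * F))" using F D_def by simp
  also have "\<dots> = F * F + 2 * fps_X * F * D" by (simp add: D_def algebra_simps)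
  finally have D: "D = F * F + 2 * fps_X * F * D" .
  show ?thesis unfolding D_def[symmetric] using X D by algebra
qed

lemma catalan_gf_eq_shapes_gf: "catalan_gf = shapes_gf"
proof -
  define c where "c = fps_nth shapes_gf"
  define b :: "nat \<Rightarrow> rat" where "b n = of_nat ((2 * n) choose n)" for n
  have c0: "c 0 = 1"
    unfolding c_def by (subst shapes_gf_equation) simp
  have c_rec: "of_nat (n + 2) * c (Suc n) = of_nat (4 * n + 2) * c n" for n
  proof -
    have "(fps_X * (1 - 4 * fps_X) * fps_deriv shapes_gf + (1 - 2 * fps_X) * shapes_gf) $ Suc n = 0"
      unfolding catalan_quadratic_linear_ODE[OF shapes_gf_equation] by simp
    then show ?thesis
      by (cases n) (simp_all add: algebra_simps c_def numeral_fps_const fps_mult_left_const_nth)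
  qed
  have b_rec: "of_nat (n + 1) * b (Suc n) = of_nat (4 * n + 2) * b n" for n
  proof -
    have "Suc n * (Suc (Suc (2 * n)) choose Suc n) = Suc (Suc (2 * n)) * (Suc (2 * n) choose n)"
      by (rule Suc_times_binomial)
    moreover have "Suc n * (Suc (2 * n) choose n) = Suc (2 * n) * (2 * n choose n)"
      using Suc_times_binomial[of n "2 * n"] binomial_symmetric[of n "Suc (2 * n)"] by simp
    ultimately have "Suc n * (Suc n * (2 * Suc n choose Suc n)) = Suc n * ((4 * n + 2) * (2 * n choose n))"
      by (simp add: algebra_simps)
    then have "Suc n * (2 * Suc n choose Suc n) = (4 * n + 2) * (2 * n choose n)"
      by (metis mult_cancel1 nat.distinct(1))
    then show ?thesis unfolding b_def by (metis Suc_eq_plus1 of_nat_mult)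
  qed
  have "of_nat (n + 1) * c n = b n" for n
  proof (induction n)
    case 0
    then show ?case by (simp add: c0 b_def)
  next
    case (Suc n)
    have "of_nat (n + 1) * (of_nat (Suc n + 1) * c (Suc n)) = of_nat (4 * n + 2) * (of_nat (n + 1) * c n)"
      using c_rec[of n] by (simp add: algebra_simps)
    also have "\<dots> = of_nat (n + 1) * b (Suc n)" unfolding Suc.IH b_rec ..
    finally show ?case by (metis mult_cancel_left of_nat_eq_0_iff Suc_eq_plus1 nat.distinct(1))
  qed
  then have "c n = b n / of_nat (n + 1)" for n
    by (metis nonzero_mult_div_cancel_left of_nat_eq_0_iff Suc_eq_plus1 nat.distinct(1))
  then show ?thesis
    by (intro fps_ext) (simp add: catalan_gf_def b_def c_def)
qed

lemma catalan_gf_equation: "catalan_gf = 1 + fps_X * catalan_gf ^ 2"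
  unfolding power2_eq_square catalan_gf_eq_shapes_gf by (rule shapes_gf_equation)

lemma shape_gf_UNIV [simp]: "shape_gf UNIV = catalan_gf"
  by (simp add: catalan_gf_eq_shapes_gf)

section \<open>Trees with prescribed monotone runs\<close>

definition trail_inc :: "shape \<Rightarrow> nat" where
  "trail_inc t = lead_dec (mirror t)"

definition trail_dec :: "shape \<Rightarrow> nat" where
  "trail_dec t = lead_inc (mirror t)"

lemma trail_dec_simps [simp]:
  "trail_dec Leaf = 0"
  "trail_dec (Node l x r) = (if r = Leaf then Suc (trail_dec l) else trail_dec r)"
  by (auto simp: trail_dec_def)

lemma trail_inc_Leaf [simp]: "trail_inc Leaf = 0"
  by (simp add: trail_inc_def)

lemma trail_mirror [simp]:
  "trail_inc (mirror t) = lead_dec t"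
  "trail_dec (mirror t) = lead_inc t"
  by (simp_all add: trail_inc_def trail_dec_def)

text \<open>
  The tree whose word is decreasing.  Such trees are the exceptional case in which a decreasing
  initial run goes on beyond the left subtree.
\<close>
fun dec_comb :: "nat \<Rightarrow> shape" where
  "dec_comb 0 = Leaf"
| "dec_comb (Suc n) = Node (dec_comb n) () Leaf"

definition inc_comb :: "nat \<Rightarrow> shape" where
  "inc_comb n = mirror (dec_comb n)"

lemma size_dec_comb [simp]: "size (dec_comb n) = n"
  by (induction n) auto

lemma lead_dec_dec_comb [simp]: "lead_dec (dec_comb n) = n"
  by (induction n) auto

lemma size_inc_comb [simp]: "size (inc_comb n) = n"
  by (simp add: inc_comb_def)

lemma lead_inc_inc_comb [simp]: "lead_inc (inc_comb n) = n"
  by (induction n) (simp_all add: inc_comb_def)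

lemma trail_inc_inc_comb [simp]: "trail_inc (inc_comb n) = n"
  by (simp add: trail_inc_def inc_comb_def)

lemma mirror_eq_dec_comb_iff: "mirror t = dec_comb n \<longleftrightarrow> t = inc_comb n"
  by (metis inc_comb_def mirror_mirror)

lemma lead_dec_eq_size_iff: "lead_dec t = size t \<longleftrightarrow> t = dec_comb (size t)"
proof (induction t)
  case (Node l x r)
  show ?case
  proof
    assume full: "lead_dec (Node l x r) = size (Node l x r)"
    then have "lead_dec l = size l \<and> r = Leaf"
      using lead_dec_le[of l] by (auto split: if_splits)
    with Node.IH(1) show "Node l x r = dec_comb (size (Node l x r))" by simp
  next
    assume "Node l x r = dec_comb (size (Node l x r))"
    then show "lead_dec (Node l x r) = size (Node l x r)"
      by (metis lead_dec_dec_comb)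
  qed
qed simp

lemma Suc_le_lead_dec_Node_iff:
  "Suc k \<le> lead_dec (Node l x r) \<longleftrightarrow> Suc k \<le> lead_dec l \<or> l = dec_comb k"
proof (cases "lead_dec l = size l")
  case True
  then have "l = dec_comb k \<longleftrightarrow> size l = k" by (metis lead_dec_eq_size_iff size_dec_comb)
  with True show ?thesis by auto
next
  case False
  then have "l \<noteq> dec_comb k" by auto
  with False show ?thesis by simp
qed

lemma Suc_le_trail_inc_Node_iff:
  "Suc k \<le> trail_inc (Node l x r) \<longleftrightarrow> Suc k \<le> trail_inc r \<or> r = inc_comb k"
  unfolding trail_inc_def mirror.simps Suc_le_lead_dec_Node_iff mirror_eq_dec_comb_iff ..

lemma shape_set_eqI:
  assumes "Leaf \<in> A \<longleftrightarrow> Leaf \<in> B"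
    and "\<And>l r. Node l () r \<in> A \<longleftrightarrow> Node l () r \<in> B"
  shows "A = B"
proof (rule set_eqI)
  fix t :: shape
  show "t \<in> A \<longleftrightarrow> t \<in> B" using assms by (cases t) auto
qed

text \<open>
  The equations for a single initial run have this form, because one subtree of a node carries
  the run while the other one is arbitrary.  The quadratic equation gives
  \<open>c = 1 / (1 - x c)\<close>.
\<close>
lemma catalan_linear_equation:
  fixes c :: "'a :: comm_ring_1"
  assumes "c = 1 + x * c ^ 2" and "b = x * (b * c) + d"
  shows "b = c * d"
proof -
  have "c * d = c * (b - x * (b * c))"
    using assms(2) by (metis add_diff_cancel_left')
  also have "\<dots> = b * (c - x * c ^ 2)"
    by (simp add: algebra_simps power2_eq_square)
  also have "c - x * c ^ 2 = 1"
    using assms(1) by (metis add_diff_cancel_right')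
  finally show ?thesis by simp
qed

lemma shape_gf_lead_dec:
  "shape_gf {t. Suc k \<le> lead_dec t} = fps_X ^ Suc k * catalan_gf ^ 2"
  "shape_gf ({t. Suc k \<le> lead_dec t} \<union> {dec_comb k}) = fps_X ^ k * catalan_gf"
proof -
  let ?D = "{t. Suc k \<le> lead_dec t}"
  have "?D = nodes (?D \<union> {dec_comb k}) UNIV"
    by (rule shape_set_eqI) (auto simp: Suc_le_lead_dec_Node_iff simp del: lead_dec.simps(2))
  then have "shape_gf ?D = fps_X * (shape_gf (?D \<union> {dec_comb k}) * catalan_gf)"
    by (metis shape_gf_nodes shape_gf_UNIV)
  moreover have plus: "shape_gf (?D \<union> {dec_comb k}) = shape_gf ?D + fps_X ^ k"
    by (subst shape_gf_Un) (auto simp: shape_gf_singleton)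
  ultimately have eq: "shape_gf ?D = fps_X * ((shape_gf ?D + fps_X ^ k) * catalan_gf)"
    by simp
  then have "shape_gf ?D = catalan_gf * (fps_X * (fps_X ^ k * catalan_gf))"
    by (intro catalan_linear_equation[OF catalan_gf_equation]) (simp add: algebra_simps)
  then show D: "shape_gf ?D = fps_X ^ Suc k * catalan_gf ^ 2"
    by (simp add: power2_eq_square mult_ac)
  have "fps_X ^ Suc k * catalan_gf ^ 2 + fps_X ^ k = fps_X ^ k * (1 + fps_X * catalan_gf ^ 2)"
    by (simp add: algebra_simps)
  then show "shape_gf (?D \<union> {dec_comb k}) = fps_X ^ k * catalan_gf"
    unfolding plus D catalan_gf_equation[symmetric] .
qed

lemma shape_gf_trail_inc_or_comb:
  "shape_gf ({t. Suc l \<le> trail_inc t} \<union> {inc_comb l}) = fps_X ^ l * catalan_gf"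
proof -
  have "{t. Suc l \<le> trail_inc t} \<union> {inc_comb l} =
      {t. mirror t \<in> {t. Suc l \<le> lead_dec t} \<union> {dec_comb l}}"
    by (auto simp: trail_inc_def mirror_eq_dec_comb_iff)
  then show ?thesis by (metis shape_gf_mirror shape_gf_lead_dec(2))
qed

lemma shape_gf_trail_inc:
  "shape_gf {t. Suc l \<le> trail_inc t} = fps_X ^ Suc l * catalan_gf ^ 2"
  using shape_gf_mirror[of "{t. Suc l \<le> lead_dec t}"]
  by (simp add: trail_inc_def shape_gf_lead_dec(1))

lemma shape_gf_lead_inc: "shape_gf {t. k \<le> lead_inc t} = fps_X ^ k * catalan_gf ^ Suc k"
proof (induction k)
  case (Suc k)
  let ?I = "\<lambda>k. {t. k \<le> lead_inc t}"
  have "?I (Suc k) = nodes (?I (Suc k)) UNIV \<union> nodes {Leaf} (?I k)"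
    by (rule shape_set_eqI) auto
  then have "shape_gf (?I (Suc k)) =
      shape_gf (nodes (?I (Suc k)) UNIV \<union> nodes {Leaf} (?I k))" by (rule arg_cong)
  also have "\<dots> = shape_gf (nodes (?I (Suc k)) UNIV) + shape_gf (nodes {Leaf} (?I k))"
    by (rule shape_gf_Un) (auto simp: nodes_def)
  also have "\<dots> = fps_X * (shape_gf (?I (Suc k)) * catalan_gf) + fps_X * shape_gf (?I k)"
    by (simp add: shape_gf_nodes shape_gf_singleton)
  finally have "shape_gf (?I (Suc k)) = catalan_gf * (fps_X * shape_gf (?I k))"
    by (rule catalan_linear_equation[OF catalan_gf_equation])
  then show ?case by (simp add: Suc.IH mult_ac)
qed simp

lemma shape_gf_trail_dec: "shape_gf {t. l \<le> trail_dec t} = fps_X ^ l * catalan_gf ^ Suc l"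
  using shape_gf_mirror[of "{t. l \<le> lead_inc t}"]
  by (simp add: trail_dec_def shape_gf_lead_inc)

lemma shape_gf_dec_inc:
  "shape_gf {t. Suc k \<le> lead_dec t \<and> Suc l \<le> trail_inc t} = fps_X ^ Suc (k + l) * catalan_gf ^ 2"
proof -
  have "{t. Suc k \<le> lead_dec t \<and> Suc l \<le> trail_inc t} =
      nodes ({t. Suc k \<le> lead_dec t} \<union> {dec_comb k}) ({t. Suc l \<le> trail_inc t} \<union> {inc_comb l})"
    by (rule shape_set_eqI)
      (auto simp: Suc_le_lead_dec_Node_iff Suc_le_trail_inc_Node_iff simp del: lead_dec.simps(2))
  then show ?thesis
    by (simp add: shape_gf_nodes shape_gf_lead_dec(2) shape_gf_trail_inc_or_comb
      power_add power2_eq_square algebra_simps del: Un_insert_right)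
qed

text \<open>
  Induction on \<open>k\<close>.  The right subtree carries the final run of length \<open>l + 1\<close>, or it is the increasing
  comb with \<open>l\<close> nodes and the root completes the run.  A nonempty left subtree carries the initial
  run.  If it is empty, then the right subtree carries the initial run, too, shortened by the root, which
  admits the comb only for \<open>k \<le> l\<close>.

  For \<open>k \<ge> 1\<close> the quotient is the geometric sum over the lengths from \<open>max k (l + 1)\<close> to \<open>k + l - 1\<close>.
  It counts the words in which the two runs share at least two letters; these words are increasing.
  For \<open>k = 0\<close> it is \<open>- x\<^sup>l\<close>, and the formula is the series
  \<open>x\<^sup>l (C - 1) = x\<^sup>l\<^sup>+\<^sup>1 C\<^sup>2\<close> for a final run alone.
\<close>
lemma shape_gf_inc_inc:
  "shape_gf {t. k \<le> lead_inc t \<and> Suc l \<le> trail_inc t} =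
    fps_X ^ (k + l) * catalan_gf ^ Suc k + (fps_X ^ max k (Suc l) - fps_X ^ (k + l)) / (1 - fps_X)"
proof -
  let ?A = "\<lambda>k. {t. k \<le> lead_inc t \<and> Suc l \<le> trail_inc t}"
  have "(1 - fps_X) * shape_gf (?A k) = (1 - fps_X) * (fps_X ^ (k + l) * catalan_gf ^ Suc k)
      + (fps_X ^ max k (Suc l) - fps_X ^ (k + l))" for k
  proof (induction k)
    case 0
    have "shape_gf (?A 0) = fps_X ^ l * (fps_X * catalan_gf ^ 2)"
      using shape_gf_trail_inc[of l] by (simp add: mult_ac)
    also have "fps_X * catalan_gf ^ 2 = catalan_gf - 1"
      using catalan_gf_equation by (metis add_diff_cancel_left')
    finally have "shape_gf (?A 0) = fps_X ^ l * (catalan_gf - 1)" .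
    then show ?case by (simp only:) (simp add: algebra_simps)
  next
    case (Suc k)
    let ?E = "if k \<le> l then {inc_comb l} else {}"
    let ?I = "{t. Suc k \<le> lead_inc t}" and ?T = "{t. Suc l \<le> trail_inc t} \<union> {inc_comb l}"
    \<comment> \<open>the series of the set \<open>?E\<close>\<close>
    define e :: "rat fps" where "e = (if k \<le> l then fps_X ^ l else 0)"
    have "?A (Suc k) = nodes ?I ?T \<union> nodes {Leaf} (?A k \<union> ?E)"
      by (rule shape_set_eqI) (auto simp: Suc_le_trail_inc_Node_iff)
    then have "shape_gf (?A (Suc k)) = shape_gf (nodes ?I ?T \<union> nodes {Leaf} (?A k \<union> ?E))"
      by (rule arg_cong)
    also have "\<dots> = shape_gf (nodes ?I ?T) + shape_gf (nodes {Leaf} (?A k \<union> ?E))"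
      by (rule shape_gf_Un) (auto simp: nodes_def)
    also have "\<dots> = fps_X * (shape_gf ?I * shape_gf ?T) + fps_X * shape_gf (?A k \<union> ?E)"
      by (simp only: shape_gf_nodes shape_gf_singleton tree.size power_0 mult_1_left)
    also have "shape_gf (?A k \<union> ?E) = shape_gf (?A k) + e"
      by (subst shape_gf_Un) (auto simp: shape_gf_singleton e_def)
    finally have step: "shape_gf (?A (Suc k)) = fps_X * (fps_X * fps_X ^ (k + l) * catalan_gf ^ Suc k
        * catalan_gf ^ 2) + fps_X * (shape_gf (?A k) + e)"
      unfolding shape_gf_lead_inc shape_gf_trail_inc_or_comb
      by (simp add: power_add power2_eq_square mult_ac)
    have max: "(1 - fps_X) * (fps_X * e) + fps_X * fps_X ^ max k (Suc l)
        = fps_X ^ max (Suc k) (Suc l)"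
      by (cases "k \<le> l") (auto simp: e_def max_def algebra_simps le_Suc_eq)
    have "(1 - fps_X) * shape_gf (?A (Suc k)) =
        (1 - fps_X) * (fps_X * fps_X ^ (k + l) * catalan_gf ^ Suc k * (fps_X * catalan_gf ^ 2))
        + fps_X * ((1 - fps_X) * shape_gf (?A k)) + (1 - fps_X) * (fps_X * e)"
      unfolding step by (simp add: algebra_simps)
    also have "\<dots> = (1 - fps_X) * (fps_X * fps_X ^ (k + l) * catalan_gf ^ Suc k
          * (1 + fps_X * catalan_gf ^ 2))
        + ((1 - fps_X) * (fps_X * e) + fps_X * fps_X ^ max k (Suc l) - fps_X * fps_X ^ (k + l))"
      unfolding Suc.IH by (simp add: algebra_simps)
    finally have "(1 - fps_X) * shape_gf (?A (Suc k)) =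
        (1 - fps_X) * (fps_X * fps_X ^ (k + l) * catalan_gf ^ Suc k * catalan_gf)
        + (fps_X ^ max (Suc k) (Suc l) - fps_X * fps_X ^ (k + l))"
      unfolding max catalan_gf_equation[symmetric] .
    then show ?case by (simp add: power_add mult_ac)
  qed
  moreover have "1 - fps_X \<noteq> (0 :: rat fps)"
  proof
    assume "1 - fps_X = (0 :: rat fps)"
    then have "(1 - fps_X :: rat fps) $ 0 = 0" by (simp only: fps_zero_nth)
    then show False by simp
  qed
  ultimately have "shape_gf (?A k) = ((1 - fps_X) * (fps_X ^ (k + l) * catalan_gf ^ Suc k)
      + (fps_X ^ max k (Suc l) - fps_X ^ (k + l))) / (1 - fps_X)"
    by (metis nonzero_mult_div_cancel_left)
  then show ?thesis by (simp add: fps_divide_add)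
qed

text \<open>
  Mirroring a tree turns decreasing initial runs into increasing final ones and decreasing
  final runs into increasing initial ones.
\<close>
lemma shape_gf_dec_dec:
  "shape_gf {t. Suc k \<le> lead_dec t \<and> l \<le> trail_dec t} =
    fps_X ^ (k + l) * catalan_gf ^ Suc l + (fps_X ^ max (Suc k) l - fps_X ^ (k + l)) / (1 - fps_X)"
proof -
  have "{t. Suc k \<le> lead_dec t \<and> l \<le> trail_dec t} =
      {t. mirror t \<in> {t. l \<le> lead_inc t \<and> Suc k \<le> trail_inc t}}"
    by (auto simp: trail_dec_def)
  then show ?thesis
    by (simp only: shape_gf_mirror shape_gf_inc_inc add.commute max.commute)
qed

definition inc_dec_gf :: "nat \<Rightarrow> nat \<Rightarrow> rat fps" where
  "inc_dec_gf k l = shape_gf {t. t \<noteq> Leaf \<and> k \<le> lead_inc t \<and> l \<le> trail_dec t}"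

lemma inc_dec_gf_0_0: "inc_dec_gf 0 0 = catalan_gf - 1"
proof -
  have "shape_gf UNIV = shape_gf ({t. t \<noteq> Leaf} \<union> {Leaf})"
    by (rule arg_cong[where f = shape_gf]) auto
  also have "\<dots> = shape_gf {t. t \<noteq> Leaf} + 1"
    by (subst shape_gf_Un) (auto simp: shape_gf_singleton)
  finally show ?thesis by (simp add: inc_dec_gf_def eq_diff_eq)
qed

lemma inc_dec_gf_Suc_0: "inc_dec_gf (Suc k) 0 = fps_X ^ Suc k * catalan_gf ^ Suc (Suc k)"
proof -
  have "{t. t \<noteq> Leaf \<and> Suc k \<le> lead_inc t \<and> 0 \<le> trail_dec t} = {t. Suc k \<le> lead_inc t}"
    by auto
  then show ?thesis by (simp only: inc_dec_gf_def shape_gf_lead_inc)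
qed

lemma inc_dec_gf_0_Suc: "inc_dec_gf 0 (Suc l) = fps_X ^ Suc l * catalan_gf ^ Suc (Suc l)"
proof -
  have "{t. t \<noteq> Leaf \<and> 0 \<le> lead_inc t \<and> Suc l \<le> trail_dec t} = {t. Suc l \<le> trail_dec t}"
    by auto
  then show ?thesis by (simp only: inc_dec_gf_def shape_gf_trail_dec)
qed

text \<open>
  An increasing initial run and a decreasing final run interact only through empty subtrees:  with two
  nonempty subtrees, each of them carries one run; with one empty subtree, the root belongs to the run
  on that side and the other subtree carries what remains; the tree with one node has both runs
  of length 1.
\<close>
lemma inc_dec_gf_Suc_Suc:
  "inc_dec_gf (Suc k) (Suc l) =
    fps_X * (fps_X ^ Suc k * catalan_gf ^ Suc (Suc k) * (fps_X ^ Suc l * catalan_gf ^ Suc (Suc l)))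
    + fps_X * inc_dec_gf k (Suc l) + fps_X * inc_dec_gf (Suc k) l
    + (if k = 0 \<and> l = 0 then fps_X else 0)"
proof -
  let ?H = "\<lambda>k l. {t. t \<noteq> Leaf \<and> k \<le> lead_inc t \<and> l \<le> trail_dec t}"
  let ?I = "{t. Suc k \<le> lead_inc t}" and ?D = "{t. Suc l \<le> trail_dec t}"
  let ?L = "nodes {Leaf} (?H k (Suc l))" and ?R = "nodes (?H (Suc k) l) {Leaf}"
  let ?E = "if k = 0 \<and> l = 0 then {Node Leaf () Leaf} else {}"
  have "?H (Suc k) (Suc l) = nodes ?I ?D \<union> ?L \<union> ?R \<union> ?E"
    by (rule shape_set_eqI) auto
  then have "inc_dec_gf (Suc k) (Suc l) = shape_gf (nodes ?I ?D \<union> ?L \<union> ?R \<union> ?E)"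
    unfolding inc_dec_gf_def by (rule arg_cong)
  also have "\<dots> = shape_gf (nodes ?I ?D \<union> ?L \<union> ?R) + shape_gf ?E"
    by (rule shape_gf_Un) (auto simp: nodes_def)
  also have "shape_gf (nodes ?I ?D \<union> ?L \<union> ?R) = shape_gf (nodes ?I ?D \<union> ?L) + shape_gf ?R"
    by (rule shape_gf_Un) (auto simp: nodes_def)
  also have "shape_gf (nodes ?I ?D \<union> ?L) = shape_gf (nodes ?I ?D) + shape_gf ?L"
    by (rule shape_gf_Un) (auto simp: nodes_def)
  also have "shape_gf ?E = (if k = 0 \<and> l = 0 then fps_X else 0)"
    by (simp add: shape_gf_singleton)
  finally show ?thesis
    by (simp only: shape_gf_nodes shape_gf_lead_inc shape_gf_trail_dec shape_gf_singleton
      inc_dec_gf_def tree.size power_0 mult_1_left mult_1_right)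
qed

section \<open>From permutations to trees\<close>

text \<open>
  The empty permutation, which is not counted, corresponds to \<open>Leaf\<close>.
\<close>
lemma perm_gf_eq_shape_gf:
  assumes "\<And>n \<pi>. q n \<pi> \<longleftrightarrow> Q (perm_word n \<pi>)" and "\<And>n \<pi>. r n \<pi> \<longleftrightarrow> R (perm_word n \<pi>)"
    and "\<And>t. Q (word 1 t) \<longleftrightarrow> Q' t" and "\<And>t. R (word 1 t) \<longleftrightarrow> R' t"
  shows "perm_gf avoids_213 q r = shape_gf {t. t \<noteq> Leaf \<and> Q' t \<and> R' t}"
proof (rule fps_ext)
  fix n
  have count: "perm_count avoids_213 q r n = card {t. size t = n \<and> Q' t \<and> R' t}"
    using perm_count_eq_card_shapes[of q n Q r R] assms by simp
  have "{t. size t = n \<and> Q' t \<and> R' t} = {t \<in> {t. t \<noteq> Leaf \<and> Q' t \<and> R' t}. size t = n}"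
    if "n \<noteq> 0" using that by auto
  moreover have "{t \<in> {t. t \<noteq> Leaf \<and> Q' t \<and> R' t}. size t = n} = {}" if "n = 0"
    using that by auto
  ultimately show "perm_gf avoids_213 q r $ n = shape_gf {t. t \<noteq> Leaf \<and> Q' t \<and> R' t} $ n"
    by (simp add: perm_gf_def shape_gf_def count)
qed

lemma perm_gf_inc_inc:
  "perm_gf avoids_213 (begins_inc k) (ends_inc l) =
    shape_gf {t. t \<noteq> Leaf \<and> k \<le> lead_inc t \<and> l \<le> trail_inc t}"
  by (rule perm_gf_eq_shape_gf[where Q = "begins (<) k" and R = "\<lambda>w. begins (>) l (rev w)"])
    (simp_all add: begins_inc_iff_word ends_inc_iff_word begins_less_word begins_greater_rev_word
      trail_inc_def)

lemma perm_gf_dec_inc: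
  "perm_gf avoids_213 (begins_dec k) (ends_inc l) =
    shape_gf {t. t \<noteq> Leaf \<and> k \<le> lead_dec t \<and> l \<le> trail_inc t}"
  by (rule perm_gf_eq_shape_gf[where Q = "begins (>) k" and R = "\<lambda>w. begins (>) l (rev w)"])
    (simp_all add: begins_dec_iff_word ends_inc_iff_word begins_greater_word begins_greater_rev_word
      trail_inc_def)

lemma perm_gf_dec_dec:
  "perm_gf avoids_213 (begins_dec k) (ends_dec l) =
    shape_gf {t. t \<noteq> Leaf \<and> k \<le> lead_dec t \<and> l \<le> trail_dec t}"
  by (rule perm_gf_eq_shape_gf[where Q = "begins (>) k" and R = "\<lambda>w. begins (<) l (rev w)"])
    (simp_all add: begins_dec_iff_word ends_dec_iff_word begins_greater_word begins_less_rev_word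
      trail_dec_def)

lemma perm_gf_inc_dec:
  "perm_gf avoids_213 (begins_inc k) (ends_dec l) = inc_dec_gf k l"
  unfolding inc_dec_gf_def
  by (rule perm_gf_eq_shape_gf[where Q = "begins (<) k" and R = "\<lambda>w. begins (<) l (rev w)"])
    (simp_all add: begins_inc_iff_word ends_dec_iff_word begins_less_word begins_less_rev_word
      trail_dec_def)

section \<open>The series in three variables\<close>

text \<open>
  Over any commutative ring of coefficients, a power series is invertible if its constant
  coefficient is.  Two applications give the inverses of power series over power series.
\<close>
lemma fps_mult_inverse_unit:
  fixes g :: "'a :: {comm_ring_1, inverse} fps"
  assumes "g $ 0 * inverse (g $ 0) = 1"
  shows "g * inverse g = 1"
  using fps_right_inverse[OF assms] by (simp add: fps_inverse_def)

lemma fps_divide_mult_unit: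
  fixes f g :: "'a :: {comm_ring_1, inverse} fps"
  assumes "g $ 0 * inverse (g $ 0) = 1"
  shows "f / g * g = f"
proof -
  have "g $ 0 \<noteq> 0" using assms by auto
  then have "f / g * g = f * (g * inverse g)" by (simp add: fps_divide_unit mult_ac)
  then show ?thesis by (simp add: fps_mult_inverse_unit[OF assms])
qed

lemma fps3_divide_mult_cancel:
  fixes f g :: fps3
  assumes "g $ 0 $ 0 = 1"
  shows "f / g * g = f"
  by (intro fps_divide_mult_unit fps_mult_inverse_unit) (simp add: assms)

lemma fps3_eq_divideI:
  fixes f g h :: fps3
  assumes "g $ 0 $ 0 = 1" and "h * g = f"
  shows "h = f / g"
proof -
  have "h * g = f / g * g" unfolding fps3_divide_mult_cancel[OF assms(1)] by (rule assms(2))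
  moreover have "g \<noteq> 0" using assms(1) by auto
  ultimately show ?thesis by simp
qed

lemma of_x_simps:
  "of_x (f * g) = of_x f * of_x g"
  "of_x (f - g) = of_x f - of_x g"
  "of_x 1 = 1"
  by (simp_all add: of_x_def)

lemma nth_of_x_mult: "(of_x f * F) $ l $ k = f * F $ l $ k"
  by (simp add: of_x_def)

lemma nth_of_x: "of_x f $ l $ k = (if l = 0 \<and> k = 0 then f else 0)"
  by (simp add: of_x_def)

lemma nth_var_y_mult: "(var_y * F) $ l $ k = (if k = 0 then 0 else F $ l $ (k - 1))"
  by (simp add: var_y_def)

lemma nth_var_z_mult: "(var_z * F) $ l $ k = (if l = 0 then 0 else F $ (l - 1) $ k)"
  by (simp add: var_z_def)

lemma nth_var_y: "var_y $ l $ k = (if l = 0 \<and> k = 1 then 1 else 0)"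
  by (simp add: var_y_def)

lemma nth_var_z: "var_z $ l $ k = (if l = 1 \<and> k = 0 then 1 else 0)"
  by (simp add: var_z_def)

lemma nth_fps3_add: "(F + G :: fps3) $ l $ k = F $ l $ k + G $ l $ k"
  by simp

lemma nth_fps3_diff: "(F - G :: fps3) $ l $ k = F $ l $ k - G $ l $ k"
  by simp

lemmas nth_fps3 = nth_of_x_mult nth_of_x nth_var_y_mult nth_var_z_mult nth_var_y nth_var_z
  nth_fps3_add nth_fps3_diff

lemma fps3_eqI: "(\<And>l k. (F :: fps3) $ l $ k = G $ l $ k) \<Longrightarrow> F = G"
  by (rule fps_ext, rule fps_ext) blast

text \<open>
  The part of the trivariate series that remains, apart from three monomials, after multiplication by
  \<open>1 - x (y + z)\<close>: a product of two geometric series.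
\<close>
definition inc_dec_source :: fps3 where
  "inc_dec_source = Abs_fps (\<lambda>l. Abs_fps (\<lambda>k.
    (catalan_gf - 1) * (fps_X * catalan_gf) ^ k * (fps_X * catalan_gf) ^ l))"

lemma nth_inc_dec_source:
  "inc_dec_source $ l $ k = (catalan_gf - 1) * (fps_X * catalan_gf) ^ k * (fps_X * catalan_gf) ^ l"
  by (simp add: inc_dec_source_def)

lemma inc_dec_source_closed_form:
  "inc_dec_source = (of_x catalan_gf - 1)
    / ((1 - var_x * var_y * of_x catalan_gf) * (1 - var_x * var_z * of_x catalan_gf))"
proof (rule fps3_eq_divideI)
  show "((1 - var_x * var_y * of_x catalan_gf) * (1 - var_x * var_z * of_x catalan_gf)) $ 0 $ 0 = 1"
    by (simp add: var_x_def var_y_def var_z_def of_x_def)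
  let ?P = "inc_dec_source" and ?a = "fps_X * catalan_gf"
  \<comment> \<open>Multiplication by \<open>1 - x z C\<close> leaves only the terms without \<open>z\<close>.\<close>
  define Q where "Q = ?P - of_x ?a * (var_z * ?P)"
  have Q: "Q $ l $ k = (if l = 0 then (catalan_gf - 1) * ?a ^ k else 0)" for l k
    unfolding Q_def nth_fps3 nth_inc_dec_source by (cases l) simp_all
  have "?P * ((1 - var_x * var_y * of_x catalan_gf) * (1 - var_x * var_z * of_x catalan_gf))
      = Q - of_x ?a * (var_y * Q)"
    by (simp add: Q_def var_x_def of_x_simps algebra_simps)
  also have "\<dots> = of_x (catalan_gf - 1)"
  proof (rule fps3_eqI)
    fix l k
    show "(Q - of_x ?a * (var_y * Q)) $ l $ k = of_x (catalan_gf - 1) $ l $ k"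
      unfolding nth_fps3 Q by (cases k) simp_all
  qed
  finally show "?P * ((1 - var_x * var_y * of_x catalan_gf) * (1 - var_x * var_z * of_x catalan_gf))
      = of_x catalan_gf - 1"
    by (simp add: of_x_simps)
qed

text \<open>
  Multiplication by \<open>1 - x (y + z)\<close> removes the two terms of the recurrence in which exactly one
  subtree is empty.  For \<open>k\<close> and \<open>l\<close> positive, \<open>x C\<^sup>2 = C - 1\<close> turns the remaining
  product \<open>x I\<^sub>k I\<^sub>l\<close> with \<open>I\<^sub>k = x\<^sup>k C\<^sup>k\<^sup>+\<^sup>1\<close> into \<open>(C - 1) (x C)\<^sup>k (x C)\<^sup>l\<close>, and the boundary values fit
  the same formula.  The monomials \<open>x y\<close>, \<open>x z\<close> and \<open>x y z\<close> come from the tree with one node and from the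
  empty tree, which is excluded from the count.
\<close>
lemma gf_213_inc_dec_closed_form:
  "gf_213_inc_dec
      = 1 / (1 - var_x * (var_y + var_z))
        * (var_x * (var_y + var_z + var_y * var_z)
           + (of_x catalan_gf - 1)
             / ((1 - var_x * var_y * of_x catalan_gf) * (1 - var_x * var_z * of_x catalan_gf)))"
proof -
  let ?T = "gf_213_inc_dec" and ?S = "var_x * (var_y + var_z + var_y * var_z) + inc_dec_source"
  let ?g = "1 - var_x * (var_y + var_z)"
  have T: "?T $ l $ k = inc_dec_gf k l" for l k
    by (simp add: gf_213_inc_dec_def perm_gf_inc_dec)
  have C: "catalan_gf - 1 = fps_X * catalan_gf ^ 2"
    using catalan_gf_equation by (metis add_diff_cancel_left')
  have rec: "?T = of_x fps_X * (var_y * ?T) + of_x fps_X * (var_z * ?T)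
      + (of_x fps_X * var_y + of_x fps_X * var_z + of_x fps_X * (var_y * var_z)) + inc_dec_source"
    (is "_ = ?R")
  proof (rule fps3_eqI)
    fix l k
    show "?T $ l $ k = ?R $ l $ k"
    proof (cases l; cases k)
      assume "l = 0" "k = 0"
      then show ?thesis
        unfolding nth_fps3 T nth_inc_dec_source by (simp add: inc_dec_gf_0_0)
    next
      fix k' assume "l = 0" "k = Suc k'"
      then show ?thesis unfolding nth_fps3 T nth_inc_dec_source
        by (cases k') (simp_all add: inc_dec_gf_0_0
          inc_dec_gf_Suc_0 algebra_simps power_mult_distrib)
    next
      fix l' assume "l = Suc l'" "k = 0"
      then show ?thesis unfolding nth_fps3 T nth_inc_dec_source
        by (cases l') (simp_all add: inc_dec_gf_0_0
          inc_dec_gf_0_Suc algebra_simps power_mult_distrib)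
    next
      fix l' k' assume "l = Suc l'" "k = Suc k'"
      then show ?thesis unfolding nth_fps3 T nth_inc_dec_source
        by (simp add: inc_dec_gf_Suc_Suc C power2_eq_square
          power_mult_distrib mult_ac)
    qed
  qed
  have "?T * ?g = ?T - (of_x fps_X * (var_y * ?T) + of_x fps_X * (var_z * ?T))"
    by (simp add: var_x_def algebra_simps)
  also have "\<dots> = ?S"
    by (subst (1) rec) (simp add: var_x_def algebra_simps)
  finally have "?T * ?g = ?S" .
  then have "?T * ?g = 1 / ?g * ?S * ?g"
    using fps3_divide_mult_cancel[of ?g 1]
    by (simp add: mult_ac var_x_def var_y_def var_z_def of_x_def)
  moreover have "?g \<noteq> 0"
  proof
    assume "?g = 0"
    then have "?g $ 0 $ 0 = 0" by simp
    then show False by (simp add: var_x_def var_y_def var_z_def of_x_def)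
  qed
  ultimately have "?T = 1 / ?g * ?S" by (metis mult_right_cancel)
  then show ?thesis unfolding inc_dec_source_closed_form .
qed

theorem proposition11:
  shows "(\<forall>k l :: nat. 1 \<le> k \<longrightarrow> 1 \<le> l \<longrightarrow>
      perm_gf avoids_213 (begins_inc k) (ends_inc l)
        = fps_X ^ (k + l - 1) * catalan_gf ^ (k + 1)
          + (fps_X ^ max k l - fps_X ^ (k + l - 1)) / (1 - fps_X)
    \<and> perm_gf avoids_213 (begins_dec k) (ends_inc l)
        = fps_X ^ (k + l - 1) * catalan_gf ^ 2
    \<and> perm_gf avoids_213 (begins_dec k) (ends_dec l)
        = fps_X ^ (k + l - 1) * catalan_gf ^ (l + 1)
          + (fps_X ^ max k l - fps_X ^ (k + l - 1)) / (1 - fps_X))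
  \<and> gf_213_inc_dec
      = 1 / (1 - var_x * (var_y + var_z))
        * (var_x * (var_y + var_z + var_y * var_z)
           + (of_x catalan_gf - 1)
             / ((1 - var_x * var_y * of_x catalan_gf) * (1 - var_x * var_z * of_x catalan_gf)))"
proof (intro conjI allI impI)
  fix k l :: nat
  assume "1 \<le> k" and "1 \<le> l"
  then obtain i j where k: "k = Suc i" and l: "l = Suc j"
    by (metis One_nat_def Suc_le_D)
  have "{t. t \<noteq> Leaf \<and> Suc i \<le> lead t \<and> Suc j \<le> trail t} =
      {t. Suc i \<le> lead t \<and> Suc j \<le> trail t}" if "lead Leaf = 0" for lead trail :: "shape \<Rightarrow> nat"
    using that by auto
  note nonempty = this[of lead_inc, OF lead_inc.simps(1)] this[of lead_dec, OF lead_dec.simps(1)]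
  show "perm_gf avoids_213 (begins_inc k) (ends_inc l)
      = fps_X ^ (k + l - 1) * catalan_gf ^ (k + 1)
        + (fps_X ^ max k l - fps_X ^ (k + l - 1)) / (1 - fps_X)"
    unfolding perm_gf_inc_inc k l nonempty shape_gf_inc_inc by simp
  show "perm_gf avoids_213 (begins_dec k) (ends_inc l) = fps_X ^ (k + l - 1) * catalan_gf ^ 2"
    unfolding perm_gf_dec_inc k l nonempty shape_gf_dec_inc by simp
  show "perm_gf avoids_213 (begins_dec k) (ends_dec l)
      = fps_X ^ (k + l - 1) * catalan_gf ^ (l + 1)
        + (fps_X ^ max k l - fps_X ^ (k + l - 1)) / (1 - fps_X)"
    unfolding perm_gf_dec_dec k l nonempty shape_gf_dec_dec by simp
qed (rule gf_213_inc_dec_closed_form)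

end
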